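(* Let $F\colon\mathbb{F}_2^n\to\mathbb{F}_2^3$ be a bent function. Then there are only four possible preimage distributions for $F$: the type $(+)$ distribution (one preimage set of size $2^{n-3}+2^{n/2}-2^{n/2-3}$ and seven of size $2^{n-3}-2^{n/2-3}$), the type $(-)$ distribution (one preimage set of size $2^{n-3}-2^{n/2}+2^{n/2-3}$ and seven of size $2^{n-3}+2^{n/2-3}$), and the two distributions whose preimage set sizes are $X_i=2^{n-3}+2^{n/2-3}(2T_i-1)$, $i=1,\dots,8$, where $$T_1=-2,\ T_2=T_3=T_4=2,\ T_5=\dots=T_8=0,$$ or $$T_1=3,\ T_2=T_3=T_4=-1,\ T_5=\dots=T_8=1.$$
   Context: A function $F\colon\mathbb{F}_2^n\to\mathbb{F}_2^m$ is bent (perfect nonlinear) if $|\{x: F(x+a)-F(x)=b\}|=2^{n-m}$ for all nonzero $a\in\mathbb{F}_2^n$ and all $b\in\mathbb{F}_2^m$. The preimage distribution of $F$ is the multiset $\{X_1,\dots,X_{2^m}\}$ of the sizes $|F^{-1}(\beta)|$, $\beta\in\mathbb{F}_2^m$; it is described up to reordering. The theorem asserts that the preimage distribution of every such $F$ is one of the four listed. *)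

theory Defs
  imports
    Complex_Main
    "HOL-Library.Multiset"
    "HOL-Library.Numeral_Type"
    "HOL-Library.Z2"
    "HOL-Analysis.Finite_Cartesian_Product"
begin

text \<open>
  The field with two elements is the type \<^typ>\<open>bit\<close>, and its coordinate space of dimension
  \<open>n = CARD('n)\<close> is \<open>bit ^ 'n\<close>. Powers of two with possibly negative or half-integral
  exponents (\<open>n - m\<close>, \<open>n / 2 - 3\<close>) are real powers, so that neither truncated subtraction
  nor integer division occurs and no parity or size assumption on \<open>n\<close> is built in.
\<close>

instance bit :: finite
proof
  have "(UNIV :: bit set) = {0, 1}"
    by (auto intro: bit.exhaust)
  then show "finite (UNIV :: bit set)"
    by (metis finite.emptyI finite.insertI)
qed

definition bent :: "(bit ^ 'n \<Rightarrow> bit ^ 'm) \<Rightarrow> bool" where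
  "bent F \<longleftrightarrow>
     (\<forall>a b. a \<noteq> 0 \<longrightarrow>
        real (card {x. F (x + a) - F x = b}) = 2 powr (real CARD('n) - real CARD('m)))"

definition preimage_distribution :: "('a \<Rightarrow> 'b::finite) \<Rightarrow> nat multiset" where
  "preimage_distribution F = image_mset (\<lambda>\<beta>. card (F -` {\<beta>})) (mset_set UNIV)"

definition plus_distribution :: "nat \<Rightarrow> real multiset" where
  "plus_distribution n =
     {# 2 powr (real n - 3) + 2 powr (real n / 2) - 2 powr (real n / 2 - 3) #}
     + replicate_mset 7 (2 powr (real n - 3) - 2 powr (real n / 2 - 3))"

definition minus_distribution :: "nat \<Rightarrow> real multiset" where
  "minus_distribution n =
     {# 2 powr (real n - 3) - 2 powr (real n / 2) + 2 powr (real n / 2 - 3) #}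
     + replicate_mset 7 (2 powr (real n - 3) + 2 powr (real n / 2 - 3))"

definition distribution_of_T :: "nat \<Rightarrow> int multiset \<Rightarrow> real multiset" where
  "distribution_of_T n T =
     image_mset (\<lambda>t. 2 powr (real n - 3) + 2 powr (real n / 2 - 3) * (2 * of_int t - 1)) T"

end

theory Submission
  imports Defs "HOL-Analysis.Cartesian_Space"
begin

text \<open>
  For \<open>b \<noteq> 0\<close> the character sum \<open>W b = (\<Sum>x. (- 1) ^ (b \<bullet> F x))\<close> of a bent function satisfies
  \<open>(W b)\<^sup>2 = 2 ^ n\<close>, so \<open>W b = e b * 2 powr (n / 2)\<close> with \<open>e b = \<plusminus> 1\<close>. Fourier inversion
  expresses \<open>8 * card (F -` {\<beta>})\<close> through the \<open>W b\<close>; with the convention \<open>e 0 = 1\<close> the sizes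
  become \<open>2 powr (n - 3) + 2 powr (n / 2 - 3) * (g \<beta> - 1)\<close>, where \<open>g\<close> is the Walsh spectrum of
  the Boolean function \<open>e\<close> in three variables. Only four spectra occur among the \<open>2 ^ 7\<close>
  functions \<open>e\<close> with \<open>e 0 = 1\<close>.
\<close>

section \<open>Characters of \<open>bit ^ 'm\<close>\<close>

definition bit_sign :: "bit \<Rightarrow> int" where
  "bit_sign u = (if u = 0 then 1 else - 1)"

text \<open>This is the additive character \<open>y \<mapsto> (- 1) ^ (b \<bullet> y)\<close>, kept
  integer-valued so that signs can be computed exactly.\<close>

definition chi :: "bit ^ 'm \<Rightarrow> bit ^ 'm \<Rightarrow> int" where
  "chi b y = bit_sign (\<Sum>i\<in>UNIV. b $ i * y $ i)"

lemma bit_sign_add: "bit_sign (u + v) = bit_sign u * bit_sign v"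
  by (cases u; cases v) (simp_all add: bit_sign_def)

lemma chi_add: "chi b (y + z) = chi b y * chi b z"
  unfolding chi_def vector_add_component distrib_left sum.distrib bit_sign_add ..

lemma chi_commute: "chi b y = chi y b"
  unfolding chi_def by (subst mult.commute) (rule refl)

lemma chi_zero [simp]: "chi 0 y = 1" "chi b 0 = 1"
  by (simp_all add: chi_def bit_sign_def)

lemma minus_bit_vec: "y - z = y + (z :: bit ^ 'm)"
  by (simp add: vec_eq_iff)

lemma chi_diff: "chi b (y - z) = chi b y * chi b z"
  by (simp add: minus_bit_vec chi_add)

lemma card_UNIV_bit: "CARD(bit) = 2"
proof -
  have UNIV_bit: "(UNIV :: bit set) = {0, 1}"
    by (auto intro: bit.exhaust)
  show ?thesis unfolding UNIV_bit by simp
qed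

text \<open>Orthogonality: if \<open>b $ i = 1\<close>, translating by the unit vector
  \<open>axis i 1\<close> flips the sign of every term, so the sum is its own negative.\<close>

lemma sum_chi_right:
  fixes b :: "bit ^ 'm"
  shows "(\<Sum>y\<in>UNIV. chi b y) = (if b = 0 then 2 ^ CARD('m) else 0)"
proof (cases "b = 0")
  case True
  then show ?thesis by (simp add: card_UNIV_bit)
next
  case False
  then obtain i where i: "b $ i = 1"
    by (metis bit_not_zero_iff vec_eq_iff zero_index)
  have "chi b (axis i 1) = - 1"
  proof -
    have "(\<Sum>j\<in>UNIV. b $ j * axis i 1 $ j) = (\<Sum>j\<in>UNIV. if j = i then 1 else 0)"
      by (rule sum.cong) (auto simp: axis_def i)
    then show ?thesis
      by (simp add: chi_def bit_sign_def)
  qed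
  moreover have "(\<Sum>y\<in>UNIV. chi b y) = (\<Sum>y\<in>UNIV. chi b (y + axis i 1))"
    by (rule sum.reindex_bij_witness[of _ "\<lambda>y. y + axis i 1" "\<lambda>y. y - axis i 1"]) auto
  ultimately have "(\<Sum>y\<in>UNIV. chi b y) = - (\<Sum>y\<in>UNIV. chi b y)"
    by (simp add: chi_add sum_negf)
  with False show ?thesis by simp
qed

lemma sum_chi_left:
  fixes y :: "bit ^ 'm"
  shows "(\<Sum>b\<in>UNIV. chi b y) = (if y = 0 then 2 ^ CARD('m) else 0)"
  using sum_chi_right[of y] by (simp add: chi_commute)

section \<open>Character sums of bent functions\<close>

definition walsh :: "('a::finite \<Rightarrow> bit ^ 'm) \<Rightarrow> bit ^ 'm \<Rightarrow> int" where
  "walsh F b = (\<Sum>x\<in>UNIV. chi b (F x))"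

lemma sum_comp_eq_sum_card:
  fixes f :: "'a::finite \<Rightarrow> 'b::finite" and g :: "'b \<Rightarrow> int"
  shows "(\<Sum>x\<in>UNIV. g (f x)) = (\<Sum>y\<in>UNIV. int (card {x. f x = y}) * g y)"
proof -
  have "(\<Sum>x\<in>UNIV. g (f x)) = (\<Sum>y\<in>UNIV. \<Sum>x\<in>{x \<in> UNIV. f x = y}. g (f x))"
    by (rule sum.group[symmetric]) auto
  also have "\<dots> = (\<Sum>y\<in>UNIV. \<Sum>x\<in>{x. f x = y}. g y)"
    by (intro sum.cong) auto
  finally show ?thesis by simp
qed

text \<open>After the sums are swapped, orthogonality in \<open>b\<close> keeps exactly those
  \<open>x\<close> with \<open>F x - \<beta> = 0\<close>.\<close>

lemma walsh_inversion:
  fixes F :: "'a::finite \<Rightarrow> bit ^ 'm"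
  shows "(\<Sum>b\<in>UNIV. chi b \<beta> * walsh F b) = 2 ^ CARD('m) * int (card (F -` {\<beta>}))"
proof -
  have "(\<Sum>b\<in>UNIV. chi b \<beta> * walsh F b) = (\<Sum>x\<in>UNIV. \<Sum>b\<in>UNIV. chi b (F x - \<beta>))"
    unfolding walsh_def sum_distrib_left
    unfolding chi_diff by (subst sum.swap) (simp only: mult.commute)
  also have "\<dots> = (\<Sum>x\<in>UNIV. if F x = \<beta> then 2 ^ CARD('m) else 0)"
    by (simp add: sum_chi_left)
  also have "\<dots> = (\<Sum>x\<in>F -` {\<beta>}. 2 ^ CARD('m))"
    by (simp add: sum.If_cases vimage_def)
  finally show ?thesis by simp
qed

lemma walsh_zero:
  fixes F :: "bit ^ 'n \<Rightarrow> bit ^ 'm"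
  shows "walsh F 0 = 2 ^ CARD('n)"
  by (simp add: walsh_def card_UNIV_bit)

text \<open>Substituting \<open>y = x + a\<close> in the double sum turns the square into a sum of
  autocorrelations over \<open>a\<close>. For \<open>a \<noteq> 0\<close> the derivative in
  direction \<open>a\<close> is balanced, so its character sum vanishes and only
  \<open>a = 0\<close> contributes.\<close>

lemma bent_walsh_squared:
  fixes F :: "bit ^ 'n \<Rightarrow> bit ^ 'm"
  assumes "bent F" "b \<noteq> 0"
  shows "(walsh F b)\<^sup>2 = 2 ^ CARD('n)"
proof -
  have autocorrelation: "(\<Sum>x\<in>UNIV. chi b (F (x + a) - F x)) = (if a = 0 then 2 ^ CARD('n) else 0)" for a
  proof (cases "a = 0")
    case True
    then show ?thesis by (simp add: card_UNIV_bit)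
  next
    case False
    define c where "c = card {x. F (x + a) - F x = 0}"
    have *: "real (card {x. F (x + a) - F x = y}) = 2 powr (real CARD('n) - real CARD('m))" for y
      using assms(1) False unfolding bent_def by blast
    \<comment> \<open>Equal real cardinalities give a single natural number \<open>c\<close>, which
      factors out of the character sum.\<close>
    have c: "card {x. F (x + a) - F x = y} = c" for y
      unfolding c_def by (simp only: of_nat_eq_iff[where 'a = real, symmetric] *)
    have "(\<Sum>x\<in>UNIV. chi b (F (x + a) - F x)) = (\<Sum>y\<in>UNIV. int c * chi b y)"
      by (simp only: sum_comp_eq_sum_card[of "chi b" "\<lambda>x. F (x + a) - F x"] c)
    also have "\<dots> = 0"
      using assms(2) by (simp add: sum_distrib_left[symmetric] sum_chi_right)
    finally show ?thesis using False by simp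
  qed
  have "(walsh F b)\<^sup>2 = (\<Sum>x\<in>UNIV. \<Sum>y\<in>UNIV. chi b (F y) * chi b (F x))"
    unfolding walsh_def power2_eq_square sum_product by (subst sum.swap) simp
  also have "\<dots> = (\<Sum>x\<in>UNIV. \<Sum>a\<in>UNIV. chi b (F (x + a)) * chi b (F x))"
  proof (rule sum.cong[OF refl])
    fix x
    show "(\<Sum>y\<in>UNIV. chi b (F y) * chi b (F x)) = (\<Sum>a\<in>UNIV. chi b (F (x + a)) * chi b (F x))"
      by (rule sum.reindex_bij_witness[of _ "\<lambda>a. x + a" "\<lambda>y. y - x"]) auto
  qed
  also have "\<dots> = (\<Sum>a\<in>UNIV. \<Sum>x\<in>UNIV. chi b (F (x + a) - F x))"
    unfolding chi_diff by (rule sum.swap)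
  finally show ?thesis by (simp add: autocorrelation)
qed

section \<open>Walsh spectra in three variables\<close>

text \<open>The vectors are listed in binary counting order; position \<open>k\<close> (from 0)
  matches the variable \<open>ek\<close> in \<open>sort_spectrum_3\<close>.\<close>

definition bit_vecs_3 :: "(bit ^ 3) list" where
  "bit_vecs_3 = [vector [0, 0, 0], vector [0, 0, 1], vector [0, 1, 0], vector [0, 1, 1],
     vector [1, 0, 0], vector [1, 0, 1], vector [1, 1, 0], vector [1, 1, 1]]"

lemma distinct_bit_vecs_3: "distinct bit_vecs_3"
  by (simp add: bit_vecs_3_def vec_eq_iff forall_3)

lemma set_bit_vecs_3: "set bit_vecs_3 = UNIV"
proof -
  have "v \<in> set bit_vecs_3" for v
    by (cases "v $ 1"; cases "v $ 2"; cases "v $ 3") (simp_all add: bit_vecs_3_def vec_eq_iff forall_3)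
  then show ?thesis by blast
qed

lemma mset_set_UNIV_bit_3: "mset_set UNIV = mset bit_vecs_3"
  using mset_set_set[OF distinct_bit_vecs_3] by (simp add: set_bit_vecs_3)

lemma sum_UNIV_bit_3: "(\<Sum>b\<in>UNIV. f b) = sum_list (map f bit_vecs_3)"
  using sum.distinct_set_conv_list[OF distinct_bit_vecs_3, of f] by (simp add: set_bit_vecs_3)

text \<open>All \<open>2 ^ 7\<close> sign patterns are evaluated; sorting makes equal multisets
  equal lists. The outcome is forced by arithmetic: the entries are even and congruent modulo 4,
  their sum is 8 and the sum of their squares is 64.\<close>

lemma sort_spectrum_3:
  fixes e1 e2 e3 e4 e5 e6 e7 :: int
  assumes "e1 = 1 \<or> e1 = - 1" "e2 = 1 \<or> e2 = - 1" "e3 = 1 \<or> e3 = - 1" "e4 = 1 \<or> e4 = - 1"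
    "e5 = 1 \<or> e5 = - 1" "e6 = 1 \<or> e6 = - 1" "e7 = 1 \<or> e7 = - 1"
  shows "sort [1 + e1 + e2 + e3 + e4 + e5 + e6 + e7, 1 - e1 + e2 - e3 + e4 - e5 + e6 - e7,
       1 + e1 - e2 - e3 + e4 + e5 - e6 - e7, 1 - e1 - e2 + e3 + e4 - e5 - e6 + e7,
       1 + e1 + e2 + e3 - e4 - e5 - e6 - e7, 1 - e1 + e2 - e3 - e4 + e5 - e6 + e7,
       1 + e1 - e2 - e3 - e4 - e5 + e6 + e7, 1 - e1 - e2 + e3 - e4 + e5 + e6 - e7] \<in>
    {[0, 0, 0, 0, 0, 0, 0, 8], [-6, 2, 2, 2, 2, 2, 2, 2],
     [-4, 0, 0, 0, 0, 4, 4, 4], [-2, -2, -2, 2, 2, 2, 2, 6]}"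
  using assms by (elim disjE; hypsubst; simp)

lemma walsh_spectrum_3:
  fixes e :: "bit ^ 3 \<Rightarrow> int"
  assumes "e 0 = 1" and signs: "\<And>b. e b \<in> {1, - 1}"
  shows "image_mset (\<lambda>\<beta>. \<Sum>b\<in>UNIV. chi b \<beta> * e b) (mset_set UNIV) \<in>
    {{#0, 0, 0, 0, 0, 0, 0, 8#}, {#-6, 2, 2, 2, 2, 2, 2, 2#},
     {#-4, 0, 0, 0, 0, 4, 4, 4#}, {#-2, -2, -2, 2, 2, 2, 2, 6#}}"
proof -
  have e0: "e (vector [0, 0, 0]) = 1"
  proof -
    have "vector [0, 0, 0] = (0 :: bit ^ 3)" by (simp add: vec_eq_iff forall_3)
    then show ?thesis using assms(1) by simp
  qed
  define l where "l = map (\<lambda>\<beta>. \<Sum>b\<in>UNIV. chi b \<beta> * e b) bit_vecs_3"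
  let ?e1 = "e (vector [0, 0, 1])" and ?e2 = "e (vector [0, 1, 0])" and ?e3 = "e (vector [0, 1, 1])"
    and ?e4 = "e (vector [1, 0, 0])" and ?e5 = "e (vector [1, 0, 1])" and ?e6 = "e (vector [1, 1, 0])"
    and ?e7 = "e (vector [1, 1, 1])"
  have signs': "e b = 1 \<or> e b = - 1" for b
    using signs[of b] by simp
  have l_eq: "l =
    [1 + ?e1 + ?e2 + ?e3 + ?e4 + ?e5 + ?e6 + ?e7, 1 - ?e1 + ?e2 - ?e3 + ?e4 - ?e5 + ?e6 - ?e7,
      1 + ?e1 - ?e2 - ?e3 + ?e4 + ?e5 - ?e6 - ?e7, 1 - ?e1 - ?e2 + ?e3 + ?e4 - ?e5 - ?e6 + ?e7,
      1 + ?e1 + ?e2 + ?e3 - ?e4 - ?e5 - ?e6 - ?e7, 1 - ?e1 + ?e2 - ?e3 - ?e4 + ?e5 - ?e6 + ?e7,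
      1 + ?e1 - ?e2 - ?e3 - ?e4 - ?e5 + ?e6 + ?e7, 1 - ?e1 - ?e2 + ?e3 - ?e4 + ?e5 + ?e6 - ?e7]"
    by (simp add: l_def sum_UNIV_bit_3 bit_vecs_3_def chi_def sum_3 bit_sign_def e0)
  have "sort l \<in>
    {[0, 0, 0, 0, 0, 0, 0, 8], [-6, 2, 2, 2, 2, 2, 2, 2],
     [-4, 0, 0, 0, 0, 4, 4, 4], [-2, -2, -2, 2, 2, 2, 2, 6]}"
    unfolding l_eq by (rule sort_spectrum_3; rule signs')
  from imageI[OF this, of mset] have "mset (sort l) \<in>
    {{#0, 0, 0, 0, 0, 0, 0, 8#}, {#-6, 2, 2, 2, 2, 2, 2, 2#},
     {#-4, 0, 0, 0, 0, 4, 4, 4#}, {#-2, -2, -2, 2, 2, 2, 2, 6#}}"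
    unfolding image_insert image_empty mset.simps .
  then show ?thesis
    by (simp only: mset_set_UNIV_bit_3 mset_map[symmetric] mset_sort l_def)
qed

lemma replicate_mset_7: "replicate_mset 7 x = {#x, x, x, x, x, x, x#}"
  by (simp add: numeral_eq_Suc)

theorem theorem5p5:
  fixes F :: "bit ^ 'n \<Rightarrow> bit ^ 3"
  assumes "bent F"
  shows "image_mset real (preimage_distribution F) \<in>
    {plus_distribution CARD('n),
     minus_distribution CARD('n),
     distribution_of_T CARD('n) {# -2, 2, 2, 2, 0, 0, 0, 0 #},
     distribution_of_T CARD('n) {# 3, -1, -1, -1, 1, 1, 1, 1 #}}"
proof -
  define n where "n = CARD('n)"
  define q :: real where "q = 2 powr (real n / 2)"
  have q_pos: "q > 0" and q_sq: "q\<^sup>2 = 2 ^ n"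
    by (simp_all add: q_def power2_eq_square powr_add[symmetric] powr_realpow)
  define h :: real where "h = 2 powr (real n / 2 - 3)"
  define N :: real where "N = 2 powr (real n - 3)"
  have q_eq: "q = 8 * h" and N_eq: "2 ^ n = 8 * N"
    unfolding q_def h_def N_def powr_diff by (simp_all add: powr_realpow)
  \<comment> \<open>The value at 0 is a convention, since \<open>walsh F 0\<close> is
    \<open>2 ^ n\<close> and not in general \<open>q\<close> or \<open>- q\<close>.\<close>
  define e where "e b = (if b = 0 then 1 else sgn (walsh F b))" for b
  have e_zero: "e 0 = 1" by (simp add: e_def)
  have walsh_eq: "of_int (walsh F b) = of_int (e b) * q" if "b \<noteq> 0" for b
  proof -
    have "(real_of_int (walsh F b))\<^sup>2 = q\<^sup>2"
      using bent_walsh_squared[OF assms that] unfolding q_sq n_def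
      by (metis of_int_numeral of_int_power)
    then have "\<bar>real_of_int (walsh F b)\<bar> = q"
      using q_pos by (auto simp: power2_eq_iff)
    then show ?thesis
      using that by (auto simp: e_def sgn_if abs_if split: if_splits)
  qed
  have e_sign: "e b \<in> {1, - 1}" for b
    using bent_walsh_squared[OF assms, of b] by (cases "b = 0") (auto simp: e_def sgn_if)
  define g where "g \<beta> = (\<Sum>b\<in>UNIV. chi b \<beta> * e b)" for \<beta>
  define size_of :: "int \<Rightarrow> real" where
    "size_of t = N + h * (of_int t - 1)" for t
  have card_eq: "real (card (F -` {\<beta>})) = size_of (g \<beta>)" for \<beta>
  proof -
    have "8 * real (card (F -` {\<beta>})) = (\<Sum>b\<in>UNIV. of_int (chi b \<beta>) * of_int (walsh F b))"
      using arg_cong[OF walsh_inversion[of \<beta> F], of real_of_int] by simp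
    also have "\<dots> = 2 ^ n + (\<Sum>b\<in>UNIV - {0}. of_int (chi b \<beta>) * of_int (walsh F b))"
      by (subst sum.remove[of _ 0]) (simp_all add: walsh_zero n_def)
    also have "(\<Sum>b\<in>UNIV - {0}. of_int (chi b \<beta>) * of_int (walsh F b))
        = q * (\<Sum>b\<in>UNIV - {0}. of_int (chi b \<beta> * e b))"
      by (simp add: sum_distrib_left walsh_eq mult_ac)
    \<comment> \<open>The \<open>- 1\<close> removes the term of \<open>g \<beta>\<close> at
      \<open>b = 0\<close>, which is \<open>e 0 = 1\<close>.\<close>
    also have "(\<Sum>b\<in>UNIV - {0}. real_of_int (chi b \<beta> * e b)) = of_int (g \<beta>) - 1"
      by (simp add: g_def sum_diff1 e_zero)
    finally show ?thesis
      unfolding size_of_def q_eq N_eq by (simp add: algebra_simps)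
  qed
  \<comment> \<open>The values \<open>T\<close> are half the spectrum entries, so the last two
    spectra only have to be halved.\<close>
  have distribution_eq: "distribution_of_T n T = image_mset size_of (image_mset ((*) 2) T)" for T
    by (simp add: distribution_of_T_def size_of_def h_def N_def multiset.map_comp comp_def)
  have "image_mset real (preimage_distribution F) = image_mset size_of (image_mset g (mset_set UNIV))"
    by (simp add: preimage_distribution_def multiset.map_comp comp_def card_eq)
  moreover have "image_mset g (mset_set UNIV) \<in>
    {{#0, 0, 0, 0, 0, 0, 0, 8#}, {#-6, 2, 2, 2, 2, 2, 2, 2#},
     {#-4, 0, 0, 0, 0, 4, 4, 4#}, {#-2, -2, -2, 2, 2, 2, 2, 6#}}"
    unfolding g_def by (rule walsh_spectrum_3[of e, OF e_zero e_sign])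
  moreover have "image_mset size_of {#0, 0, 0, 0, 0, 0, 0, 8#} = plus_distribution n"
  proof -
    \<comment> \<open>With \<open>q = 8 * h\<close>, the exceptional size is
      \<open>N + q - h = N + 7 * h\<close>, which is \<open>size_of 8\<close>.\<close>
    have "plus_distribution n = {#size_of 8#} + replicate_mset 7 (size_of 0)"
      unfolding plus_distribution_def size_of_def h_def[symmetric] N_def[symmetric]
        q_def[symmetric] q_eq by simp
    then show ?thesis
      by (simp only: replicate_mset_7 image_mset_add_mset image_mset_empty union_mset_add_mset_left
          empty_neutral add_mset_commute)
  qed
  moreover have "image_mset size_of {#-6, 2, 2, 2, 2, 2, 2, 2#} = minus_distribution n"
  proof -
    \<comment> \<open>Here the exceptional size is \<open>N - q + h = N - 7 * h\<close>, which is
      \<open>size_of (- 6)\<close>.\<close>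
    have "minus_distribution n = {#size_of (- 6)#} + replicate_mset 7 (size_of 2)"
      unfolding minus_distribution_def size_of_def h_def[symmetric] N_def[symmetric]
        q_def[symmetric] q_eq by simp
    then show ?thesis
      by (simp only: replicate_mset_7 image_mset_add_mset image_mset_empty union_mset_add_mset_left
          empty_neutral)
  qed
  moreover have "image_mset size_of {#-4, 0, 0, 0, 0, 4, 4, 4#}
      = distribution_of_T n {# -2, 2, 2, 2, 0, 0, 0, 0 #}"
    unfolding distribution_eq by (rule arg_cong[of _ _ "image_mset size_of"]) simp
  moreover have "image_mset size_of {#-2, -2, -2, 2, 2, 2, 2, 6#}
      = distribution_of_T n {# 3, -1, -1, -1, 1, 1, 1, 1 #}"
    unfolding distribution_eq by (rule arg_cong[of _ _ "image_mset size_of"]) simp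
  ultimately show ?thesis
    unfolding n_def by (elim insertE emptyE) (simp_all only: insert_iff simp_thms)
qed

end
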